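(* Let $V$ be a topological vector space over $\mathbb{R}$, and let $P=\{v^n\}_{n\in\mathbb{N}}\subset V$ be a bounded sequence. If $A\subset V$ is a non-meager Baire set, then the set $$\Delta_P(A)=\{t\in\mathbb{R} : \text{there exists } z\in V \text{ such that } tP+z\subset A\}$$ has nonempty interior in $\mathbb{R}$.
   Context: A topological vector space is a real vector space $V$ with a topology such that addition $V\times V\to V$ and scalar multiplication $\mathbb{R}\times V\to V$ are continuous (no Hausdorff or metrizability assumption is made). A set $P\subset V$ is bounded if for every nonempty open set $U\subset V$ there exist $t>0$ and $z\in V$ such that $tP+z\subset U$; a sequence is bounded if its set of terms is bounded. A subset of a topological space is meager if it is a countable union of nowhere dense sets, and non-meager if it is not meager. A subset $A$ of a topological space is called Baire if there exist an open set $U$ and a meager set $M$ such that $A$ equals the symmetric difference of $U$ and $M$ (i.e., $A$ has the property of Baire). Here $tP+z=\{tv^n+z : n\in\mathbb{N}\}$. *)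

theory Defs
  imports "HOL-Analysis.Analysis"
begin

text \<open>
  Topological vector spaces over the reals, without any separation axiom. The class
  \<open>topological_comm_monoid_add\<close> provides joint continuity of addition; joint continuity of
  scalar multiplication is phrased in the same style. Both are restated below in terms of the
  product topology.
\<close>

class topological_real_vector = real_vector + topological_comm_monoid_add +
  assumes tendsto_scaleR_Pair:
    "LIM x (nhds c \<times>\<^sub>F nhds a). fst x *\<^sub>R snd x :> nhds (c *\<^sub>R a)"

lemma continuous_add_topological_real_vector:
  "continuous_on UNIV (\<lambda>x :: 'a :: topological_real_vector \<times> 'a. fst x + snd x)"
  unfolding continuous_on_def
proof
  fix x :: "'a \<times> 'a"
  have "((\<lambda>x. fst x + snd x) \<longlongrightarrow> fst x + snd x) (nhds x)"
    using tendsto_add_Pair[of "fst x" "snd x"] by (simp add: nhds_prod[symmetric])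
  then show "((\<lambda>x. fst x + snd x) \<longlongrightarrow> fst x + snd x) (at x within UNIV)"
    by (rule filterlim_mono) (auto simp: at_within_def)
qed

lemma continuous_scaleR_topological_real_vector:
  "continuous_on UNIV (\<lambda>x :: real \<times> 'a :: topological_real_vector. fst x *\<^sub>R snd x)"
  unfolding continuous_on_def
proof
  fix x :: "real \<times> 'a"
  have "((\<lambda>x. fst x *\<^sub>R snd x) \<longlongrightarrow> fst x *\<^sub>R snd x) (nhds x)"
    using tendsto_scaleR_Pair[of "fst x" "snd x"] by (simp add: nhds_prod[symmetric])
  then show "((\<lambda>x. fst x *\<^sub>R snd x) \<longlongrightarrow> fst x *\<^sub>R snd x) (at x within UNIV)"
    by (rule filterlim_mono) (auto simp: at_within_def)
qed

instance real_normed_vector < topological_real_vector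
proof
  fix c :: real and a :: 'a
  show "LIM x (nhds c \<times>\<^sub>F nhds a). fst x *\<^sub>R snd x :> nhds (c *\<^sub>R a)"
    unfolding nhds_prod[symmetric]
    by (intro tendsto_scaleR) (auto simp: nhds_prod intro: filterlim_fst filterlim_snd)
qed

text \<open>
  Boundedness in the sense of affine copies: every nonempty open set contains some
  \<open>t P + z\<close> with \<open>t > 0\<close>. This is unrelated to the metric constant \<open>bounded\<close>.
\<close>

definition tvs_bounded :: "'a :: topological_real_vector set \<Rightarrow> bool" where
  "tvs_bounded P \<longleftrightarrow>
    (\<forall>U. open U \<and> U \<noteq> {} \<longrightarrow> (\<exists>t>0. \<exists>z. (\<lambda>v. t *\<^sub>R v + z) ` P \<subseteq> U))"

definition nowhere_dense :: "'a :: topological_space set \<Rightarrow> bool" where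
  "nowhere_dense S \<longleftrightarrow> interior (closure S) = {}"

definition meager :: "'a :: topological_space set \<Rightarrow> bool" where
  "meager S \<longleftrightarrow> (\<exists>F. countable F \<and> (\<forall>N\<in>F. nowhere_dense N) \<and> S = \<Union>F)"

definition Baire_set :: "'a :: topological_space set \<Rightarrow> bool" where
  "Baire_set A \<longleftrightarrow> (\<exists>U M. open U \<and> meager M \<and> A = sym_diff U M)"

text \<open>The scale \<open>t\<close> ranges over all reals, including zero and negative values.\<close>

definition Delta :: "'a :: real_vector set \<Rightarrow> 'a set \<Rightarrow> real set" where
  "Delta P A = {t. \<exists>z. (\<lambda>v. t *\<^sub>R v + z) ` P \<subseteq> A}"

end

theory Submission
  imports Defs
begin

text \<open>
  Write \<open>A\<close> as the symmetric difference of an open set \<open>U\<close> and a meager set \<open>M\<close>. Since \<open>A\<close> is not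
  meager, \<open>U\<close> is nonempty, say \<open>u \<in> U\<close>. The proof has two independent ingredients.

  The first is uniformity in the scale. The map \<open>(s, x, w) \<mapsto> s x + w\<close> is continuous and sends
  \<open>(0, 0, u)\<close> into \<open>U\<close>, so it sends a box \<open>S \<times> N \<times> W\<close> around that point into \<open>U\<close>. Boundedness
  supplies \<open>t > 0\<close> and \<open>z\<close> with \<open>t P + z \<subseteq> N\<close>. Hence for every \<open>s \<in> S\<close> and every \<open>w \<in> W\<close> the copy
  \<open>s (t P + z) + w = s t P + (s z + w)\<close> of \<open>P\<close> lies in \<open>U\<close>. So each scale \<open>\<tau> = s t\<close> from the open
  neighbourhood \<open>t S\<close> of \<open>0\<close> admits a whole nonempty open set \<open>s z + W\<close> of translation vectors
  (lemma \<open>open_many_translates\<close>).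

  The second is category. The translation vectors that move some term of the sequence into \<open>M\<close> form
  a countable union of translates of \<open>M\<close>, which is meager. A nonempty open set is not meager as soon
  as some subset of the space is not meager, because countably many dilates of a neighbourhood of
  \<open>0\<close> cover the space (lemma \<open>not_meager_open\<close>). Therefore one of the available translation vectors
  puts the whole copy of \<open>P\<close> into \<open>U - M \<subseteq> A\<close>, and \<open>t S\<close> is contained in the set of scales.
\<close>

section \<open>Meager sets\<close>

lemma nowhere_dense_subset:
  assumes "nowhere_dense T" "S \<subseteq> T"
  shows "nowhere_dense S"
  using assms interior_mono[OF closure_mono[OF assms(2)]] by (auto simp: nowhere_dense_def)

lemma meager_subset:
  assumes "meager T" "S \<subseteq> T"
  shows "meager S"
proof -
  obtain F where F: "countable F" "\<forall>N\<in>F. nowhere_dense N" "T = \<Union>F"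
    using assms(1) by (auto simp: meager_def)
  have "S = \<Union>((\<lambda>N. N \<inter> S) ` F)"
    using assms(2) F(3) by auto
  moreover have "\<forall>N\<in>(\<lambda>N. N \<inter> S) ` F. nowhere_dense N"
    using F(2) by (auto intro: nowhere_dense_subset)
  ultimately show ?thesis
    unfolding meager_def using F(1) by blast
qed

lemma meager_UN:
  assumes "countable I" and "\<And>i. i \<in> I \<Longrightarrow> meager (S i)"
  shows "meager (\<Union>i\<in>I. S i)"
proof -
  have "\<forall>i\<in>I. \<exists>F. countable F \<and> (\<forall>N\<in>F. nowhere_dense N) \<and> S i = \<Union>F"
    using assms(2) by (auto simp: meager_def)
  then obtain F where F: "\<And>i. i \<in> I \<Longrightarrow> countable (F i)"
      "\<And>i N. i \<in> I \<Longrightarrow> N \<in> F i \<Longrightarrow> nowhere_dense N" "\<And>i. i \<in> I \<Longrightarrow> S i = \<Union>(F i)"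
    by (metis (no_types, lifting))
  have "countable (\<Union>i\<in>I. F i)"
    using assms(1) F(1) by blast
  moreover have "\<forall>N\<in>(\<Union>i\<in>I. F i). nowhere_dense N"
    using F(2) by blast
  moreover have "(\<Union>i\<in>I. S i) = \<Union>(\<Union>i\<in>I. F i)"
    using F(3) by auto
  ultimately show ?thesis
    unfolding meager_def by blast
qed

lemma nowhere_dense_homeomorphism_image:
  assumes hom: "homeomorphism UNIV UNIV f g" and S: "nowhere_dense S"
  shows "nowhere_dense (f ` S)"
proof -
  have f: "continuous_on UNIV f" and g: "continuous_on UNIV g"
    and gf: "\<And>x. g (f x) = x" and fg: "\<And>y. f (g y) = y"
    using hom by (auto simp: homeomorphism_def)
  have "closed (g -` closure S)"
    using g by (simp add: closed_vimage)
  moreover have "f ` S \<subseteq> g -` closure S"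
    using closure_subset gf by fastforce
  ultimately have closure_sub: "closure (f ` S) \<subseteq> g -` closure S"
    by (rule closure_minimal[rotated])
  have "f -` interior (closure (f ` S)) \<subseteq> closure S"
    using closure_sub interior_subset gf by fastforce
  moreover have "open (f -` interior (closure (f ` S)))"
    using f by (simp add: open_vimage)
  ultimately have "f -` interior (closure (f ` S)) = {}"
    using S interior_maximal unfolding nowhere_dense_def by blast
  then have "interior (closure (f ` S)) = {}"
    using fg by (metis vimageI2 empty_iff equals0I)
  then show ?thesis
    by (simp add: nowhere_dense_def)
qed

lemma meager_homeomorphism_image:
  assumes hom: "homeomorphism UNIV UNIV f g" and S: "meager S"
  shows "meager (f ` S)"
proof -
  obtain F where F: "countable F" "\<forall>N\<in>F. nowhere_dense N" "S = \<Union>F"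
    using S by (auto simp: meager_def)
  have "f ` S = \<Union>((`) f ` F)"
    using F(3) by auto
  moreover have "\<forall>N\<in>(`) f ` F. nowhere_dense N"
    using F(2) nowhere_dense_homeomorphism_image[OF hom] by blast
  ultimately show ?thesis
    unfolding meager_def using F(1) by blast
qed

section \<open>Category in topological vector spaces\<close>

lemma continuous_on_scaleR_tvs:
  fixes g :: "'b :: topological_space \<Rightarrow> 'a :: topological_real_vector"
  assumes "continuous_on S f" "continuous_on S g"
  shows "continuous_on S (\<lambda>x. f x *\<^sub>R g x)"
  using continuous_on_compose2[OF continuous_scaleR_topological_real_vector
      continuous_on_Pair[OF assms]] by simp

lemma homeomorphism_affine_tvs:
  fixes b :: "'a :: topological_real_vector"
  assumes "c \<noteq> 0"
  shows "homeomorphism UNIV UNIV (\<lambda>x. c *\<^sub>R x + b) (\<lambda>y. inverse c *\<^sub>R (y + - b))"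
  unfolding homeomorphism_def
proof (intro conjI ballI)
  show "continuous_on UNIV (\<lambda>x. c *\<^sub>R x + b)"
    by (intro continuous_on_add continuous_on_scaleR_tvs continuous_intros)
  show "continuous_on UNIV (\<lambda>y. inverse c *\<^sub>R (y + - b))"
    by (intro continuous_on_add continuous_on_scaleR_tvs continuous_intros)
  show "(\<lambda>x. c *\<^sub>R x + b) ` UNIV = UNIV"
    by (rule surjI[where f = "\<lambda>y. inverse c *\<^sub>R (y + - b)"]) (use assms in simp)
  show "(\<lambda>y. inverse c *\<^sub>R (y + - b)) ` UNIV = UNIV"
    by (rule surjI[where f = "\<lambda>x. c *\<^sub>R x + b"]) (use assms in simp)
qed (use assms in simp_all)

lemma meager_affine_image:
  fixes S :: "'a :: topological_real_vector set"
  assumes "meager S" "c \<noteq> 0"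
  shows "meager ((\<lambda>x. c *\<^sub>R x + b) ` S)"
  using meager_homeomorphism_image[OF homeomorphism_affine_tvs[OF assms(2)] assms(1)] .

text \<open>
  For \<open>u \<in> W\<close> the sets \<open>n (W - u)\<close> with \<open>n = 1, 2, 3, \<dots>\<close> cover the space, since \<open>u + x / n\<close> tends
  to \<open>u\<close> for every \<open>x\<close>. So a nonempty meager open set would make the whole space meager.
\<close>

lemma not_meager_open:
  fixes W A :: "'a :: topological_real_vector set"
  assumes "open W" "W \<noteq> {}" "\<not> meager A"
  shows "\<not> meager W"
proof
  assume "meager W"
  obtain u where u: "u \<in> W"
    using assms(2) by blast
  define D where "D n = (\<lambda>x. real (Suc n) *\<^sub>R x + - (real (Suc n) *\<^sub>R u)) ` W" for n
  have "meager (D n)" for n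
    unfolding D_def by (rule meager_affine_image[OF \<open>meager W\<close>]) simp
  then have "meager (\<Union>n. D n)"
    by (intro meager_UN) auto
  moreover have "x \<in> (\<Union>n. D n)" for x
  proof -
    define f where "f s = s *\<^sub>R x + u" for s :: real
    have "continuous_on UNIV f"
      unfolding f_def by (intro continuous_on_add continuous_on_scaleR_tvs continuous_intros)
    then have "open (f -` W)"
      using assms(1) by (simp add: open_vimage)
    moreover have "0 \<in> f -` W"
      using u by (simp add: f_def)
    ultimately have "eventually (\<lambda>n. inverse (real (Suc n)) \<in> f -` W) sequentially"
      using LIMSEQ_inverse_real_of_nat topological_tendstoD by blast
    then obtain n where n: "f (inverse (real (Suc n))) \<in> W"
      by (auto simp: eventually_sequentially)
    have "x = real (Suc n) *\<^sub>R f (inverse (real (Suc n))) + - (real (Suc n) *\<^sub>R u)"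
      by (simp add: f_def scaleR_right_distrib del: of_nat_Suc)
    with n show ?thesis
      unfolding D_def by blast
  qed
  ultimately have "meager A"
    by (auto intro: meager_subset)
  with assms(3) show False ..
qed

section \<open>Scales near zero\<close>

text \<open>
  Boundedness only promises a copy of \<open>P\<close> at one scale inside a given open set. Shrinking that copy
  towards \<open>0\<close> keeps it small, and this gives an open set of scales at once; the continuity of
  \<open>(s, x, w) \<mapsto> s x + w\<close> also leaves room to move the shrunken copies.
\<close>

lemma open_many_translates:
  fixes P U :: "'a :: topological_real_vector set"
  assumes "tvs_bounded P" "open U" "U \<noteq> {}"
  obtains T where "open T" "0 \<in> T"
    "\<And>\<tau>. \<tau> \<in> T \<Longrightarrow> \<exists>Y. open Y \<and> Y \<noteq> {} \<and> (\<forall>y\<in>Y. (\<lambda>v. \<tau> *\<^sub>R v + y) ` P \<subseteq> U)"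
proof -
  obtain u where u: "u \<in> U"
    using assms(3) by blast
  define f where "f p = fst p *\<^sub>R fst (snd p) + snd (snd p)" for p :: "real \<times> 'a \<times> 'a"
  have "continuous_on UNIV f"
    unfolding f_def by (intro continuous_on_add continuous_on_scaleR_tvs continuous_intros)
  then have "open (f -` U)"
    using assms(2) by (simp add: open_vimage)
  moreover have "(0, 0, u) \<in> f -` U"
    using u by (simp add: f_def)
  ultimately obtain S Q where SQ: "open S" "open Q" "(0, 0, u) \<in> S \<times> Q" "S \<times> Q \<subseteq> f -` U"
    by (rule open_prod_elim)
  then have "0 \<in> S" "(0, u) \<in> Q"
    by auto
  from SQ(2) \<open>(0, u) \<in> Q\<close> obtain N W
    where NW: "open N" "open W" "(0, u) \<in> N \<times> W" "N \<times> W \<subseteq> Q"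
    by (rule open_prod_elim)
  then have "0 \<in> N" "u \<in> W"
    by auto
  have box: "s *\<^sub>R x + w \<in> U" if "s \<in> S" "x \<in> N" "w \<in> W" for s x w
  proof -
    have "(s, x, w) \<in> f -` U"
      using SQ(4) NW(4) that by blast
    then show ?thesis
      by (simp add: f_def)
  qed
  obtain t z where t: "t > 0" and z: "(\<lambda>v. t *\<^sub>R v + z) ` P \<subseteq> N"
    using assms(1) NW(1) \<open>0 \<in> N\<close> unfolding tvs_bounded_def by blast
  show thesis
  proof
    show "open ((\<lambda>\<tau>. \<tau> / t) -` S)"
      using SQ(1) t by (intro open_vimage continuous_intros) auto
    show "0 \<in> (\<lambda>\<tau>. \<tau> / t) -` S"
      using \<open>0 \<in> S\<close> by simp
    show "\<exists>Y. open Y \<and> Y \<noteq> {} \<and> (\<forall>y\<in>Y. (\<lambda>v. \<tau> *\<^sub>R v + y) ` P \<subseteq> U)"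
      if "\<tau> \<in> (\<lambda>\<tau>. \<tau> / t) -` S" for \<tau>
    proof -
      define s where "s = \<tau> / t"
      have s: "s \<in> S" "\<tau> = s * t"
        using that t by (auto simp: s_def)
      \<comment> \<open>This is \<open>s z + W\<close>, written as a preimage so that it is visibly open.\<close>
      define Y where "Y = (\<lambda>y. y + - (s *\<^sub>R z)) -` W"
      have "open Y"
        unfolding Y_def using NW(2)
        by (intro open_vimage continuous_on_add continuous_intros)
      moreover have "u + s *\<^sub>R z \<in> Y"
        using \<open>u \<in> W\<close> by (simp add: Y_def)
      moreover have "\<tau> *\<^sub>R v + y \<in> U" if "v \<in> P" "y \<in> Y" for v y
      proof -
        have "s *\<^sub>R (t *\<^sub>R v + z) + (y + - (s *\<^sub>R z)) \<in> U"
          using that z s(1) by (intro box) (auto simp: Y_def)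
        then show ?thesis
          by (simp add: s(2) algebra_simps)
      qed
      ultimately show ?thesis
        by blast
    qed
  qed
qed

theorem theorem3p3:
  fixes v :: "nat \<Rightarrow> 'a :: topological_real_vector"
    and A :: "'a set"
  assumes "tvs_bounded (range v)"
    and "Baire_set A"
    and "\<not> meager A"
  shows "interior (Delta (range v) A) \<noteq> {}"
proof -
  obtain U M where U: "open U" and M: "meager M" and A: "A = sym_diff U M"
    using assms(2) by (auto simp: Baire_set_def)
  have "U \<noteq> {}"
    using assms(3) M A by auto
  then obtain T where T: "open T" "0 \<in> T"
    "\<And>\<tau>. \<tau> \<in> T \<Longrightarrow> \<exists>Y. open Y \<and> Y \<noteq> {} \<and> (\<forall>y\<in>Y. (\<lambda>v. \<tau> *\<^sub>R v + y) ` range v \<subseteq> U)"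
    using open_many_translates[OF assms(1) U] by blast
  have "\<tau> \<in> Delta (range v) A" if "\<tau> \<in> T" for \<tau>
  proof -
    obtain Y where Y: "open Y" "Y \<noteq> {}"
      and YU: "\<And>y. y \<in> Y \<Longrightarrow> (\<lambda>v. \<tau> *\<^sub>R v + y) ` range v \<subseteq> U"
      using T(3)[OF \<open>\<tau> \<in> T\<close>] by blast
    \<comment> \<open>The translation vectors that move some term into \<open>M\<close>.\<close>
    define B where "B = (\<Union>n. (\<lambda>x. 1 *\<^sub>R x + - (\<tau> *\<^sub>R v n)) ` M)"
    have "meager B"
      unfolding B_def by (intro meager_UN meager_affine_image M) auto
    then have "\<not> Y \<subseteq> B"
      using not_meager_open[OF Y assms(3)] meager_subset by blast
    then obtain y where y: "y \<in> Y" "y \<notin> B"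
      by blast
    have "\<tau> *\<^sub>R v n + y \<notin> M" for n
    proof
      assume "\<tau> *\<^sub>R v n + y \<in> M"
      moreover have "y = 1 *\<^sub>R (\<tau> *\<^sub>R v n + y) + - (\<tau> *\<^sub>R v n)"
        by simp
      ultimately have "y \<in> B"
        unfolding B_def by blast
      with y(2) show False ..
    qed
    then have "(\<lambda>v. \<tau> *\<^sub>R v + y) ` range v \<subseteq> A"
      using YU[OF y(1)] A by auto
    then show ?thesis
      by (auto simp: Delta_def)
  qed
  then have "T \<subseteq> interior (Delta (range v) A)"
    using T(1) by (intro interior_maximal) auto
  with T(2) show ?thesis
    by blast
qed

end
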